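(* Let $d_1,d_2$ be positive integers, $D=d_1d_2$, and let $\rho=|\psi\rangle\langle\psi|$ be any pure state on $M^D$ (with $|\psi\rangle$ a unit vector in $\mathbb{C}^{d_1}\otimes\mathbb{C}^{d_2}$). Then there exists a factorization $M^D=\mathcal{A}_1\otimes\mathcal{A}_2$ (of type $(d_1,d_2)$) such that $\rho$ is separable with respect to it, and there exists another factorization $M^D=\mathcal{B}_1\otimes\mathcal{B}_2$ (of type $(d_1,d_2)$) such that $\rho$ is maximally entangled with respect to it.
   Context: $M^n$ denotes the algebra of complex $n\times n$ matrices; $M^D$ is identified with $M^{d_1}\otimes M^{d_2}$ acting on $\mathbb{C}^{d_1}\otimes\mathbb{C}^{d_2}$. A state (density matrix) is $\rho\in M^D$ with $\rho=\rho^\dagger$, $\rho\ge 0$, $\operatorname{Tr}\rho=1$. A factorization of $M^D$ of type $(d_1,d_2)$ is a pair of subalgebras $\mathcal{A}_1=U(M^{d_1}\otimes \mathbb{1})U^\dagger$, $\mathcal{A}_2=U(\mathbb{1}\otimes M^{d_2})U^\dagger$ for some unitary $U\in M^D$; one writes $M^D=\mathcal{A}_1\otimes\mathcal{A}_2$. A state $\rho$ is separable with respect to $M^{d_1}\otimes M^{d_2}$ if $\rho=\sum_i \rho_{i1}\otimes\rho_{i2}$ (finite sum) with positive semidefinite $\rho_{i1}\in M^{d_1}$, $\rho_{i2}\in M^{d_2}$; otherwise it is entangled. It is separable (entangled) with respect to the factorization given by $U$ if $U^\dagger\rho U$ is separable (entangled) with respect to $M^{d_1}\otimes M^{d_2}$.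 A pure state $|\chi\rangle\langle\chi|$ is maximally entangled with respect to $M^{d_1}\otimes M^{d_2}$ if $|\chi\rangle=\frac{1}{\sqrt d}\sum_{i=1}^d|\psi_{1,i}\rangle\otimes|\psi_{2,i}\rangle$ with $d=\min(d_1,d_2)$, $\{|\psi_{1,i}\rangle\}_{i=1}^d$ orthonormal in $\mathbb{C}^{d_1}$ and $\{|\psi_{2,i}\rangle\}_{i=1}^d$ orthonormal in $\mathbb{C}^{d_2}$. A pure state $|\psi\rangle\langle\psi|$ is maximally entangled with respect to the factorization given by $U$ if $U^\dagger|\psi\rangle\langle\psi|U$ is maximally entangled with respect to $M^{d_1}\otimes M^{d_2}$. *)

theory Defs
  imports "HOL-Analysis.Analysis"
begin

text \<open>
  The dimensions are the cardinalities of two finite index types: the positive integers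
  \<open>d\<^sub>1\<close>, \<open>d\<^sub>2\<close> are \<open>CARD('d1)\<close>, \<open>CARD('d2)\<close>. The space
  \<open>\<complex>\<^sup>d\<^sup>1 \<otimes> \<complex>\<^sup>d\<^sup>2\<close> is the space of vectors indexed by \<open>'d1 \<times> 'd2\<close>, so that
  matrices over this index type form \<open>M\<^sup>D\<close> with \<open>D = CARD('d1 \<times> 'd2) = d\<^sub>1 d\<^sub>2\<close>.
\<close>

definition cinner :: "complex^'n \<Rightarrow> complex^'n \<Rightarrow> complex" where
  "cinner x y = (\<Sum>i\<in>UNIV. cnj (x $ i) * y $ i)"

definition dagger :: "complex^'n^'m \<Rightarrow> complex^'m^'n" where
  "dagger A = (\<chi> i j. cnj (A $ j $ i))"

definition unitary :: "complex^'n^'n \<Rightarrow> bool" where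
  "unitary U \<longleftrightarrow> dagger U ** U = mat 1 \<and> U ** dagger U = mat 1"

definition psd :: "complex^'n^'n \<Rightarrow> bool" where
  "psd A \<longleftrightarrow> dagger A = A \<and> (\<forall>x. 0 \<le> Re (cinner x (A *v x)))"

definition is_state :: "complex^'n^'n \<Rightarrow> bool" where
  "is_state \<rho> \<longleftrightarrow> psd \<rho> \<and> trace \<rho> = 1"

definition ketbra :: "complex^'n \<Rightarrow> complex^'n^'n" where
  "ketbra \<psi> = (\<chi> i j. \<psi> $ i * cnj (\<psi> $ j))"

definition tensor_vec ::
  "complex^'d1::finite \<Rightarrow> complex^'d2::finite \<Rightarrow> complex^('d1 \<times> 'd2)" where
  "tensor_vec x y = (\<chi> p. x $ fst p * y $ snd p)"

definition tensor_mat ::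
  "complex^'d1^'d1::finite \<Rightarrow> complex^'d2^'d2::finite \<Rightarrow>
    complex^('d1 \<times> 'd2)^('d1 \<times> 'd2)" where
  "tensor_mat A B = (\<chi> p q. A $ fst p $ fst q * B $ snd p $ snd q)"

definition factorization_by ::
  "complex^('d1::finite \<times> 'd2::finite)^('d1 \<times> 'd2) \<Rightarrow>
    (complex^('d1 \<times> 'd2)^('d1 \<times> 'd2)) set \<Rightarrow>
    (complex^('d1 \<times> 'd2)^('d1 \<times> 'd2)) set \<Rightarrow> bool" where
  "factorization_by U A1 A2 \<longleftrightarrow>
     unitary U \<and>
     A1 = {U ** tensor_mat a (mat 1) ** dagger U | a. True} \<and>
     A2 = {U ** tensor_mat (mat 1) b ** dagger U | b. True}"

definition separable ::
  "complex^('d1::finite \<times> 'd2::finite)^('d1 \<times> 'd2) \<Rightarrow> bool" where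
  "separable \<rho> \<longleftrightarrow> is_state \<rho> \<and>
     (\<exists>(N::nat) (\<rho>1 :: nat \<Rightarrow> complex^'d1^'d1) (\<rho>2 :: nat \<Rightarrow> complex^'d2^'d2).
        (\<forall>i<N. psd (\<rho>1 i) \<and> psd (\<rho>2 i)) \<and>
        \<rho> = (\<Sum>i<N. tensor_mat (\<rho>1 i) (\<rho>2 i)))"

definition orthonormal_family :: "nat \<Rightarrow> (nat \<Rightarrow> complex^'n) \<Rightarrow> bool" where
  "orthonormal_family d e \<longleftrightarrow>
     (\<forall>i<d. \<forall>j<d. cinner (e i) (e j) = (if i = j then 1 else 0))"

definition maximally_entangled ::
  "complex^('d1::finite \<times> 'd2::finite)^('d1 \<times> 'd2) \<Rightarrow> bool" where
  "maximally_entangled \<rho> \<longleftrightarrow>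
     (\<exists>\<phi>. norm \<phi> = 1 \<and> \<rho> = ketbra \<phi> \<and>
       (let d = min CARD('d1) CARD('d2) in
        \<exists>(\<psi>1 :: nat \<Rightarrow> complex^'d1) (\<psi>2 :: nat \<Rightarrow> complex^'d2).
          orthonormal_family d \<psi>1 \<and> orthonormal_family d \<psi>2 \<and>
          \<phi> = (1 / sqrt (real d)) *\<^sub>R (\<Sum>i<d. tensor_vec (\<psi>1 i) (\<psi>2 i))))"

definition separable_wrt ::
  "complex^('d1::finite \<times> 'd2::finite)^('d1 \<times> 'd2) \<Rightarrow>
    complex^('d1 \<times> 'd2)^('d1 \<times> 'd2) \<Rightarrow> bool" where
  "separable_wrt U \<rho> \<longleftrightarrow> separable (dagger U ** \<rho> ** U)"

definition maximally_entangled_wrt ::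
  "complex^('d1::finite \<times> 'd2::finite)^('d1 \<times> 'd2) \<Rightarrow>
    complex^('d1 \<times> 'd2)^('d1 \<times> 'd2) \<Rightarrow> bool" where
  "maximally_entangled_wrt U \<rho> \<longleftrightarrow> maximally_entangled (dagger U ** \<rho> ** U)"

end

theory Submission
  imports Defs
begin

text \<open>
  Unitaries act transitively on unit vectors, so \<open>\<psi> = U \<phi>\<close> may be arranged both for a product
  vector \<open>\<phi>\<close> and for a maximally entangled \<open>\<phi>\<close>. Such a \<open>U\<close> is the identity plus a matrix of rank
  one: with \<open>u = \<phi> - \<psi>\<close> take \<open>U = 1 - a |u\<rangle>\<langle>u|\<close>, \<open>a = 1 / \<langle>u, \<phi>\<rangle>\<close>; it is unitary because
  \<open>a + cnj a = |a|\<^sup>2 \<langle>u, u\<rangle>\<close>. If \<open>\<langle>u, \<phi>\<rangle> = 0\<close> then \<open>u = 0\<close>, and the junk value \<open>a = 0\<close> gives \<open>U = 1\<close>.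
\<close>

text \<open>Bridge between the Hermitian form and the norm in which the unit-vector hypotheses are
  phrased.\<close>

lemma cinner_self: "cinner x x = of_real ((norm x)\<^sup>2)"
proof -
  have "(norm x)\<^sup>2 = (\<Sum>i\<in>UNIV. (norm (x $ i))\<^sup>2)"
    by (simp add: norm_vec_def L2_set_def real_sqrt_pow2 sum_nonneg)
  then show ?thesis
    by (simp add: cinner_def mult.commute flip: complex_norm_square of_real_power)
qed

lemma cinner_diff_left: "cinner (x - y) z = cinner x z - cinner y z"
  by (simp add: cinner_def left_diff_distrib sum_subtractf)

lemma cinner_diff_right: "cinner z (x - y) = cinner z x - cinner z y"
  by (simp add: cinner_def right_diff_distrib sum_subtractf)

lemma cnj_cinner: "cnj (cinner x y) = cinner y x"
  by (simp add: cinner_def mult.commute)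

lemma cinner_sum_left: "cinner (\<Sum>i\<in>I. f i) z = (\<Sum>i\<in>I. cinner (f i) z)"
  by (simp add: cinner_def sum_distrib_right) (rule sum.swap)

lemma cinner_sum_right: "cinner z (\<Sum>i\<in>I. f i) = (\<Sum>i\<in>I. cinner z (f i))"
  by (simp add: cinner_def sum_distrib_left) (rule sum.swap)

lemma cinner_scaleR: "cinner (a *\<^sub>R x) (b *\<^sub>R y) = of_real (a * b) * cinner x y"
  by (simp add: cinner_def scaleR_conv_of_real[where 'a=complex] sum_distrib_left mult_ac)

lemma cinner_tensor_vec:
  "cinner (tensor_vec x y) (tensor_vec x' y') = cinner x x' * cinner y y'"
  unfolding cinner_def sum_product sum.cartesian_product UNIV_Times_UNIV
  by (simp add: tensor_vec_def split_def mult_ac)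

lemma cinner_axis: "cinner (axis i 1) (axis j 1) = (if i = j then 1 else 0)"
proof -
  have "cnj (axis i 1 $ k) * axis j 1 $ k = (if k = j then if i = j then 1 else 0 else 0)" for k
    by (simp add: axis_def)
  then show ?thesis
    by (simp add: cinner_def)
qed

lemma cinner_ketbra: "cinner x (ketbra u *v x) = of_real ((cmod (cinner u x))\<^sup>2)"
proof -
  have "(ketbra u *v x) $ i = u $ i * cinner u x" for i
    by (simp add: cinner_def matrix_vector_mult_def ketbra_def sum_distrib_left mult_ac)
  then have "cinner x (ketbra u *v x) = cinner x u * cinner u x"
    by (simp add: cinner_def[of x] sum_distrib_left mult_ac)
  then show ?thesis
    by (simp only: complex_norm_square cnj_cinner mult.commute)
qed

lemma psd_ketbra: "psd (ketbra u)"
  by (simp add: psd_def cinner_ketbra) (simp add: dagger_def ketbra_def vec_eq_iff mult.commute)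

lemma trace_ketbra: "trace (ketbra u) = cinner u u"
  by (simp add: trace_def ketbra_def cinner_def mult.commute)

lemma dagger_ketbra_conjugation: "dagger U ** ketbra x ** U = ketbra (dagger U *v x)"
  by (simp add: vec_eq_iff matrix_matrix_mult_def matrix_vector_mult_def ketbra_def dagger_def
      sum_distrib_left sum_distrib_right mult_ac)

lemma tensor_mat_ketbra: "tensor_mat (ketbra x) (ketbra y) = ketbra (tensor_vec x y)"
  by (simp add: tensor_mat_def ketbra_def tensor_vec_def vec_eq_iff mult_ac)

text \<open>Since |u><u| squares to <u,u> |u><u|, multiplying out (1 - cnj a |u><u|)(1 - a |u><u|)
  leaves 1 - (a + cnj a - |a|^2 <u,u>) |u><u|, and the assumption cancels the bracket.\<close>

lemma unitary_rank_one_perturbation: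
  fixes u :: "complex^'n"
  assumes "a + cnj a = a * cnj a * cinner u u"
  shows "unitary (\<chi> i j. (if i = j then 1 else 0) - a * (u $ i * cnj (u $ j)))"
    (is "unitary ?U")
proof -
  have "(dagger ?U ** ?U) $ i $ j = mat 1 $ i $ j" for i j
  proof -
    define t where "t = u $ i * cnj (u $ j)"
    have "(dagger ?U ** ?U) $ i $ j =
        (\<Sum>k\<in>UNIV. (if k = i then if i = j then 1 else 0 else 0)
          - (if k = i then a * t else 0) - (if k = j then cnj a * t else 0)
          + a * cnj a * t * (cnj (u $ k) * u $ k))"
      by (auto simp: matrix_matrix_mult_def dagger_def t_def algebra_simps intro!: sum.cong)
    also have "\<dots> = (if i = j then 1 else 0) - (a + cnj a - a * cnj a * cinner u u) * t"
      unfolding sum.distrib sum_subtractf cinner_def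
      by (simp add: algebra_simps flip: sum_distrib_left)
    finally show ?thesis
      by (simp add: assms mat_def)
  qed
  then have "dagger ?U ** ?U = mat 1"
    by (simp add: vec_eq_iff)
  then show ?thesis
    by (simp add: unitary_def matrix_left_right_inverse)
qed

lemma unitary_transitive_on_unit_vectors:
  fixes \<phi> \<psi> :: "complex^'n"
  assumes "norm \<phi> = 1" and "norm \<psi> = 1"
  obtains U where "unitary U" and "U *v \<phi> = \<psi>"
proof -
  define u where "u = \<phi> - \<psi>"
  define z where "z = cinner u \<phi>"
  define U :: "complex^'n^'n"
    where "U = (\<chi> i j. (if i = j then 1 else 0) - inverse z * (u $ i * cnj (u $ j)))"
  \<comment> \<open>For unit vectors z = 1 - <\<psi>,\<phi>>, while <u,u> = 2 - <\<phi>,\<psi>> -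
    <\<psi>,\<phi>>.\<close>
  have uu: "cinner u u = z + cnj z"
    using assms
    by (simp add: u_def z_def cinner_diff_left cinner_diff_right cnj_cinner
        cinner_self[of \<phi>] cinner_self[of \<psi>])
  have u0: "u = 0" if "z = 0"
    using uu that by (simp add: cinner_self)
  have "unitary U"
    unfolding U_def
  proof (rule unitary_rank_one_perturbation)
    show "inverse z + cnj (inverse z) = inverse z * cnj (inverse z) * cinner u u"
      \<comment> \<open>For nonzero z this is 1/z + 1/cnj z = (z + cnj z) / |z|^2; for z = 0 both
        sides vanish.\<close>
      by (cases "z = 0") (simp_all add: uu field_simps)
  qed
  moreover have "(U *v \<phi>) $ i = \<psi> $ i" for i
  proof -
    have "(U *v \<phi>) $ i =
        (\<Sum>k\<in>UNIV. (if k = i then \<phi> $ i else 0) - inverse z * u $ i * (cnj (u $ k) * \<phi> $ k))"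
      by (auto simp: matrix_vector_mult_def U_def algebra_simps intro!: sum.cong)
    also have "\<dots> = \<phi> $ i - inverse z * u $ i * z"
      by (simp add: sum_subtractf z_def cinner_def flip: sum_distrib_left)
    \<comment> \<open>If z is nonzero it cancels, leaving \<phi> - u = \<psi>; if z = 0 then u = 0
      and \<phi> = \<psi> already.\<close>
    also have "\<dots> = \<psi> $ i"
      using u0 by (cases "z = 0") (auto simp: u_def field_simps)
    finally show ?thesis .
  qed
  ultimately show ?thesis
    using that by (simp add: vec_eq_iff)
qed

text \<open>If \<open>U\<close> sends \<phi> to \<psi>, its adjoint sends \<psi> back to \<phi>.
  Both halves of the theorem thus reduce to exhibiting one suitable unit vector \<phi>.\<close>

lemma factorization_pulling_back_ketbra:
  fixes \<phi> \<psi> :: "complex^('d1::finite \<times> 'd2::finite)"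
  assumes "norm \<phi> = 1" and "norm \<psi> = 1"
  obtains U A1 A2 where "factorization_by U A1 A2" and "dagger U ** ketbra \<psi> ** U = ketbra \<phi>"
proof -
  obtain U where U: "unitary U" "U *v \<phi> = \<psi>"
    using unitary_transitive_on_unit_vectors assms by blast
  then have "dagger U *v \<psi> = \<phi>"
    by (auto simp: unitary_def matrix_vector_mul_assoc)
  with U(1) that show ?thesis
    by (simp add: dagger_ketbra_conjugation factorization_by_def)
qed

lemma separable_ketbra_tensor_vec:
  assumes "norm (tensor_vec x y) = 1"
  shows "separable (ketbra (tensor_vec x y))"
proof -
  have "is_state (ketbra (tensor_vec x y))"
    using assms by (simp add: is_state_def psd_ketbra trace_ketbra cinner_self)
  then show ?thesis
    \<comment> \<open>The projector onto a product vector is itself a product of projectors, so a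
      sum with one term suffices.\<close>
    unfolding separable_def
    by (intro conjI exI[of _ "Suc 0"] exI[of _ "\<lambda>_. ketbra x"] exI[of _ "\<lambda>_. ketbra y"])
      (simp_all add: psd_ketbra tensor_mat_ketbra)
qed

lemma norm_eq_1_if_cinner: "cinner x x = 1 \<Longrightarrow> norm x = 1"
proof -
  assume "cinner x x = 1"
  then have "(norm x)\<^sup>2 = 1"
    by (metis cinner_self of_real_eq_1_iff)
  then show ?thesis
    using norm_ge_zero[of x] by (auto simp: power2_eq_1_iff simp del: norm_ge_zero)
qed

text \<open>Standard basis vectors, listed along an enumeration of the index type, are orthonormal
  on any initial segment because the enumeration is injective.\<close>

lemma orthonormal_family_exists:
  assumes "d \<le> CARD('n::finite)"
  obtains e :: "nat \<Rightarrow> complex^'n" where "orthonormal_family d e"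
proof -
  obtain g :: "nat \<Rightarrow> 'n" where "bij_betw g {0..<CARD('n)} UNIV"
    using ex_bij_betw_nat_finite[OF finite] by blast
  then have "inj_on g {..<d}"
    using assms by (auto simp: bij_betw_def intro: inj_on_subset)
  then have "orthonormal_family d (\<lambda>i. axis (g i) 1)"
    by (auto simp: orthonormal_family_def cinner_axis inj_on_def)
  then show ?thesis
    using that by blast
qed

text \<open>The inner product expands into a double sum of products of Kronecker deltas. Only the d
  diagonal terms survive, and the two prefactors contribute 1/d.\<close>

lemma norm_maximally_entangled_vec:
  assumes "d > 0" and e: "orthonormal_family d e" and f: "orthonormal_family d f"
  shows "norm ((1 / sqrt (real d)) *\<^sub>R (\<Sum>i<d. tensor_vec (e i) (f i))) = 1"
proof (rule norm_eq_1_if_cinner)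
  have "(\<Sum>j<d. cinner (e j) (e i) * cinner (f j) (f i)) = (\<Sum>j<d. if j = i then 1 else 0)"
    if "i < d" for i
    using e f that by (intro sum.cong) (auto simp: orthonormal_family_def)
  then have "(\<Sum>i<d. \<Sum>j<d. cinner (e j) (e i) * cinner (f j) (f i)) = of_nat d"
    by simp
  with \<open>d > 0\<close> show "cinner ((1 / sqrt (real d)) *\<^sub>R (\<Sum>i<d. tensor_vec (e i) (f i)))
      ((1 / sqrt (real d)) *\<^sub>R (\<Sum>i<d. tensor_vec (e i) (f i))) = 1"
    by (simp add: cinner_scaleR cinner_sum_left cinner_sum_right cinner_tensor_vec
        flip: of_real_mult)
qed

theorem theorem1:
  fixes \<psi> :: "complex^('d1::finite \<times> 'd2::finite)"
    and \<rho> :: "complex^('d1 \<times> 'd2)^('d1 \<times> 'd2)"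
  assumes "norm \<psi> = 1"
    and "\<rho> = ketbra \<psi>"
  shows "(\<exists>A1 A2 U. factorization_by U A1 A2 \<and> separable_wrt U \<rho>) \<and>
         (\<exists>B1 B2 V. factorization_by V B1 B2 \<and> maximally_entangled_wrt V \<rho>)"
proof
  \<comment> \<open>Any pair of basis vectors gives a product unit vector; \<open>undefined\<close>
    merely names some index.\<close>
  define \<phi> :: "complex^('d1 \<times> 'd2)"
    where "\<phi> = tensor_vec (axis undefined 1) (axis undefined 1)"
  have "norm \<phi> = 1"
    by (rule norm_eq_1_if_cinner) (simp add: \<phi>_def cinner_tensor_vec cinner_axis)
  then show "\<exists>A1 A2 U. factorization_by U A1 A2 \<and> separable_wrt U \<rho>"
    using factorization_pulling_back_ketbra[OF _ assms(1)] separable_ketbra_tensor_vec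
    unfolding separable_wrt_def assms(2) \<phi>_def by metis
next
  define d where "d = min CARD('d1) CARD('d2)"
  have "d \<le> CARD('d1)" and "d \<le> CARD('d2)"
    by (auto simp: d_def)
  then obtain e :: "nat \<Rightarrow> complex^'d1" and f :: "nat \<Rightarrow> complex^'d2"
    where e: "orthonormal_family d e" and f: "orthonormal_family d f"
    using orthonormal_family_exists by metis
  define \<phi> where "\<phi> = (1 / sqrt (real d)) *\<^sub>R (\<Sum>i<d. tensor_vec (e i) (f i))"
  \<comment> \<open>Here d > 0 because both index types are nonempty.\<close>
  have "norm \<phi> = 1"
    unfolding \<phi>_def using e f by (intro norm_maximally_entangled_vec) (simp_all add: d_def)
  moreover from this have "maximally_entangled (ketbra \<phi>)"
    unfolding maximally_entangled_def Let_def d_def[symmetric] using e f \<phi>_def by blast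
  ultimately show "\<exists>B1 B2 V. factorization_by V B1 B2 \<and> maximally_entangled_wrt V \<rho>"
    using factorization_pulling_back_ketbra[OF _ assms(1)]
    unfolding maximally_entangled_wrt_def assms(2) by metis
qed

end
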